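(* Suppose that $A\in\mathbb{R}^{n\times n}$ has real eigenvalues $\lambda_1,\dots,\lambda_n$ and is diagonalizable, that is, there exists a non-singular matrix $T\in\mathbb{R}^{n\times n}$ such that $A=TDT^{-1}$ with $D:=\operatorname{diag}(\lambda_1,\dots,\lambda_n)$. If for any $k\in\{1,\dots,\lceil\frac{n-1}{2}\rceil\}$ and any $\alpha\in Q^{k,n}$ we have $$\det(T)\,s(\alpha,\beta)\,T(\alpha|\beta)\,T(\bar\alpha|\bar\beta)\ge 0\quad\text{for all }\beta\in Q^{k,n},$$ and this holds with a strict inequality for at least one $\beta\in Q^{k,n}$, then $A$ is an EP-matrix.
   Context: A matrix in $\mathbb{R}^{n\times n}$ is called a P-matrix if all its principal minors are positive. A matrix $A\in\mathbb{R}^{n\times n}$ is called an EP-matrix (exponential P-matrix) if $\exp(At)$ is a P-matrix for all $t\ge 0$. $Q^{k,n}$ denotes the set of increasing sequences of $k$ numbers from $\{1,\dots,n\}$ (identified with $k$-element subsets). For $\alpha,\beta\in Q^{k,n}$, $T(\alpha|\beta)$ denotes the minor of $T$ given by the determinant of the submatrix with rows indexed by $\alpha$ and columns indexed by $\beta$. For $\alpha\in Q^{k,n}$, $\bar\alpha:=\{1,\dots,n\}\setminus\alpha$, with elements in increasing order. For $\alpha,\beta\in Q^{k,n}$, $s(\alpha,\beta):=(-1)^{\sum_{j\in\alpha}j+\sum_{i\in\beta}i}$. *)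

theory Defs
  imports
    Complex_Main
    "Jordan_Normal_Form.Determinant"
    "Jordan_Normal_Form.Char_Poly"
    "Jordan_Normal_Form.DL_Submatrix"
begin

(* Matrix indices run over {0..<n}, so the subset alpha of {1..n} in the usual
   one-based notation is represented by {j - 1 | j in alpha}. *)

definition Q :: "nat \<Rightarrow> nat \<Rightarrow> nat set set" where
  "Q k n = {\<alpha>. \<alpha> \<subseteq> {0..<n} \<and> card \<alpha> = k}"

definition minor :: "real mat \<Rightarrow> nat set \<Rightarrow> nat set \<Rightarrow> real" where
  "minor T \<alpha> \<beta> = det (submatrix T \<alpha> \<beta>)"

(* The exponent is the sum of the one-based indices. *)
definition sgn_pair :: "nat set \<Rightarrow> nat set \<Rightarrow> real" where
  "sgn_pair \<alpha> \<beta> = (- 1) ^ ((\<Sum>j\<in>\<alpha>. Suc j) + (\<Sum>i\<in>\<beta>. Suc i))"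

(* The power series of the matrix exponential, summed entrywise because the type of
   matrices of arbitrary size carries no topology. For a square matrix each of these
   real series converges absolutely. *)
definition exp_mat :: "real mat \<Rightarrow> real mat" where
  "exp_mat A = mat (dim_row A) (dim_col A) (\<lambda>(i, j). \<Sum>k. (A ^\<^sub>m k) $$ (i, j) / fact k)"

definition P_matrix :: "real mat \<Rightarrow> bool" where
  "P_matrix A \<longleftrightarrow> square_mat A \<and>
     (\<forall>\<alpha>. \<alpha> \<noteq> {} \<and> \<alpha> \<subseteq> {0..<dim_row A} \<longrightarrow> minor A \<alpha> \<alpha> > 0)"

definition EP_matrix :: "real mat \<Rightarrow> bool" where
  "EP_matrix A \<longleftrightarrow> square_mat A \<and> (\<forall>t\<ge>0. P_matrix (exp_mat (t \<cdot>\<^sub>m A)))"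

end

theory Submission
  imports Defs
begin

text \<open>
  Write \<open>E = diag(exp(t \<lambda>\<^sub>j))\<close>, so that \<open>exp(t A) = T E T\<^sup>-\<^sup>1\<close>. The principal minor of this matrix at \<open>\<alpha>\<close> is
  the determinant of the matrix obtained by replacing the rows outside \<open>\<alpha>\<close> by rows of the
  identity, and that matrix is \<open>G T\<^sup>-\<^sup>1\<close>, where \<open>G\<close> has the rows of \<open>T E\<close> in \<open>\<alpha>\<close> and the rows of \<open>T\<close>
  elsewhere. Laplace expansion of \<open>det G\<close> along the rows \<open>\<alpha>\<close> gives
  \<open>det(T)\<^sup>-\<^sup>1 \<Sum>\<^sub>\<beta> s(\<alpha>,\<beta>) T(\<alpha>|\<beta>) T(\<alpha>'|\<beta>') \<Prod>\<^sub>j\<^sub>\<in>\<^sub>\<beta> exp(t \<lambda>\<^sub>j)\<close> with complements \<open>\<alpha>'\<close>, \<open>\<beta>'\<close>. By hypothesis all terms are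
  nonnegative and one is positive if \<open>\<alpha>\<close> has at most half of the indices; exchanging
  \<open>(\<alpha>,\<beta>)\<close> with \<open>(\<alpha>',\<beta>')\<close> leaves a term unchanged, which settles larger proper subsets, and for
  the full index set the sum has the single term \<open>det T det E\<close>.
\<close>

section \<open>Increasing enumeration of index sets, and submatrices\<close>

text \<open>Exactly the \<open>k\<close> values at smaller arguments lie below \<open>f k\<close> in
  the image, and an element of a set is what \<open>pick\<close> returns at the number of elements
  below it.\<close>

lemma pick_unique:
  assumes mono: "strict_mono_on {..<m} f" and k: "k < m"
  shows "pick (f ` {..<m}) k = f k"
proof -
  have inj: "inj_on f {..<m}"
    using mono by (rule strict_mono_on_imp_inj_on)
  have "{a \<in> f ` {..<m}. a < f k} = f ` {..<k}"
    using mono k by (auto simp: strict_mono_on_less)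
  then have "card {a \<in> f ` {..<m}. a < f k} = k"
    using inj k by (simp add: card_image inj_on_subset)
  then show ?thesis
    using pick_card_in_set[of "f k" "f ` {..<m}"] k by simp
qed

lemma strict_mono_on_pick: "strict_mono_on {..<card S} (pick S)"
  by (auto simp: strict_mono_on_def intro: pick_mono_le)

lemma pick_image_lessThan_card:
  assumes "finite S"
  shows "pick S ` {..<card S} = S"
proof (rule card_subset_eq[OF assms])
  show "pick S ` {..<card S} \<subseteq> S" by (auto intro: pick_in_set_le)
  show "card (pick S ` {..<card S}) = card S"
    using strict_mono_on_imp_inj_on[OF strict_mono_on_pick] by (simp add: card_image)
qed

lemma pick_image:
  assumes S: "finite S" and mono: "strict_mono_on S f" and k: "k < card S"
  shows "pick (f ` S) k = f (pick S k)"
proof -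
  have img: "f ` S = (\<lambda>i. f (pick S i)) ` {..<card S}"
    using pick_image_lessThan_card[OF S] by (metis image_image)
  have "strict_mono_on {..<card S} (\<lambda>i. f (pick S i))"
    using mono by (auto simp: strict_mono_on_def intro!: pick_mono_le pick_in_set_le)
  from pick_unique[OF this k] show ?thesis unfolding img .
qed

lemma pick_atLeastLessThan: "k < m \<Longrightarrow> pick {a..<a + m} k = a + k"
  using pick_unique[of m "\<lambda>i. a + i" k]
  by (simp add: strict_mono_on_def lessThan_atLeast0 image_add_atLeastLessThan add.commute)

lemma submatrix_carrier:
  assumes "M \<in> carrier_mat n m" "I \<subseteq> {0..<n}" "J \<subseteq> {0..<m}"
  shows "submatrix M I J \<in> carrier_mat (card I) (card J)"
proof -
  have "{i. i < n \<and> i \<in> I} = I" "{j. j < m \<and> j \<in> J} = J" using assms by auto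
  then show ?thesis using assms by (auto simp: dim_submatrix)
qed

lemma submatrix_index':
  assumes "M \<in> carrier_mat n m" "I \<subseteq> {0..<n}" "J \<subseteq> {0..<m}" "i < card I" "j < card J"
  shows "submatrix M I J $$ (i, j) = M $$ (pick I i, pick J j)"
proof -
  have "{i. i < n \<and> i \<in> I} = I" "{j. j < m \<and> j \<in> J} = J" using assms by auto
  then show ?thesis using assms by (intro submatrix_index) auto
qed

lemma transpose_submatrix:
  "transpose_mat (submatrix M I J) = submatrix (transpose_mat M) J I"
  by (rule eq_matI) (simp_all add: submatrix_def pick_le)

text \<open>A submatrix depends on its row set only through the order in which the rows are listed,
  and a strictly increasing relabelling keeps that order.\<close>

lemma submatrix_reindex_rows:
  assumes M: "M \<in> carrier_mat n m" and N: "N \<in> carrier_mat n m"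
    and I: "I \<subseteq> {0..<n}" "f ` I \<subseteq> {0..<n}" and J: "J \<subseteq> {0..<m}"
    and mono: "strict_mono_on I f"
    and entries: "\<And>i j. i \<in> I \<Longrightarrow> j < m \<Longrightarrow> N $$ (f i, j) = M $$ (i, j)"
  shows "submatrix N (f ` I) J = submatrix M I J"
proof (rule eq_matI)
  have fin: "finite I" using I(1) finite_subset by blast
  have card: "card (f ` I) = card I"
    using strict_mono_on_imp_inj_on[OF mono] by (rule card_image)
  note cM = submatrix_carrier[OF M I(1) J] and cN = submatrix_carrier[OF N I(2) J]
  show "dim_row (submatrix N (f ` I) J) = dim_row (submatrix M I J)"
    "dim_col (submatrix N (f ` I) J) = dim_col (submatrix M I J)"
    using cM cN card by auto
  fix i j assume "i < dim_row (submatrix M I J)" "j < dim_col (submatrix M I J)"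
  then have ij: "i < card I" "j < card J" using cM by auto
  have "pick I i \<in> I" "pick J j < m" 
    using J pick_in_set_le[OF ij(1)] pick_in_set_le[OF ij(2)] by auto
  then show "submatrix N (f ` I) J $$ (i, j) = submatrix M I J $$ (i, j)"
    using ij card
    by (simp add: submatrix_index'[OF N I(2) J] submatrix_index'[OF M I(1) J]
        pick_image[OF fin mono] entries)
qed

section \<open>Determinants of matrices supported on two complementary blocks\<close>

text \<open>The factorisation is reduced to that of a block diagonal matrix by sorting the columns and the rows
  with adjacent swaps (the columns via the transpose); each swap keeps both submatrices and flips
  the sign of both \<^const>\<open>det\<close> and \<^const>\<open>sgn_pair\<close>.\<close>

definition det_factors :: "nat \<Rightarrow> nat set \<Rightarrow> nat set \<Rightarrow> bool" where
  "det_factors n \<alpha> \<beta> \<longleftrightarrow> (\<forall>M\<in>carrier_mat n n.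
     (\<forall>i<n. \<forall>j<n. (i \<in> \<alpha>) \<noteq> (j \<in> \<beta>) \<longrightarrow> M $$ (i, j) = 0) \<longrightarrow>
     det M = sgn_pair \<alpha> \<beta> * minor M \<alpha> \<beta> * minor M ({0..<n} - \<alpha>) ({0..<n} - \<beta>))"

lemma sgn_pair_commute: "sgn_pair \<alpha> \<beta> = sgn_pair \<beta> \<alpha>"
  unfolding sgn_pair_def by (simp add: add.commute)

lemma minor_transpose:
  assumes "M \<in> carrier_mat n n" "\<alpha> \<subseteq> {0..<n}" "\<beta> \<subseteq> {0..<n}" "card \<alpha> = card \<beta>"
  shows "minor (transpose_mat M) \<beta> \<alpha> = minor M \<alpha> \<beta>"
  unfolding minor_def transpose_submatrix[symmetric]
  using submatrix_carrier[OF assms(1-3)] assms(4) by (intro det_transpose[of _ "card \<alpha>"]) auto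

lemma card_complement:
  assumes "\<alpha> \<subseteq> {0..<n}"
  shows "card ({0..<n} - \<alpha>) = n - card \<alpha>"
  using assms finite_subset by (subst card_Diff_subset) auto

text \<open>Lets rows stand in for columns. Equal cardinalities make both submatrices square, so
  that their determinants survive transposition.\<close>

lemma det_factors_transpose:
  assumes f: "det_factors n \<beta> \<alpha>" and sub: "\<alpha> \<subseteq> {0..<n}" "\<beta> \<subseteq> {0..<n}" and card: "card \<alpha> = card \<beta>"
  shows "det_factors n \<alpha> \<beta>"
  unfolding det_factors_def
proof (intro ballI impI)
  fix M :: "real mat"
  assume M: "M \<in> carrier_mat n n"
    and zero: "\<forall>i<n. \<forall>j<n. (i \<in> \<alpha>) \<noteq> (j \<in> \<beta>) \<longrightarrow> M $$ (i, j) = 0"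
  have "det (transpose_mat M) = sgn_pair \<beta> \<alpha> * minor (transpose_mat M) \<beta> \<alpha> *
      minor (transpose_mat M) ({0..<n} - \<beta>) ({0..<n} - \<alpha>)"
    using f M zero unfolding det_factors_def
    by (elim ballE[of _ _ "transpose_mat M"]) auto
  then show "det M = sgn_pair \<alpha> \<beta> * minor M \<alpha> \<beta> * minor M ({0..<n} - \<alpha>) ({0..<n} - \<beta>)"
    using M sub card
    by (simp add: det_transpose sgn_pair_commute minor_transpose card_complement)
qed

text \<open>The sorted case: the matrix is literally block diagonal, and the exponent of the sign is
  twice a sum.\<close>

lemma det_factors_initial:
  assumes k: "k \<le> n"
  shows "det_factors n {0..<k} {0..<k}"
  unfolding det_factors_def
proof (intro ballI impI)
  fix M :: "real mat"
  assume M: "M \<in> carrier_mat n n"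
    and zero: "\<forall>i<n. \<forall>j<n. (i \<in> {0..<k}) \<noteq> (j \<in> {0..<k}) \<longrightarrow> M $$ (i, j) = 0"
  let ?A = "submatrix M {0..<k} {0..<k}" and ?D = "submatrix M {k..<n} {k..<n}"
  have sub: "{0..<k} \<subseteq> {0..<n}" "{k..<n} \<subseteq> {0..<n}" using k by auto
  have cA: "?A \<in> carrier_mat k k" and cD: "?D \<in> carrier_mat (n - k) (n - k)"
    using submatrix_carrier[OF M sub(1) sub(1)] submatrix_carrier[OF M sub(2) sub(2)] by auto
  have iA: "?A $$ (i, j) = M $$ (i, j)" if "i < k" "j < k" for i j
    using that pick_atLeastLessThan[of _ k 0] by (simp add: submatrix_index'[OF M sub(1) sub(1)])
  have iD: "?D $$ (i, j) = M $$ (k + i, k + j)" if "i < n - k" "j < n - k" for i j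
    using that k pick_atLeastLessThan[of _ "n - k" k]
    by (simp add: submatrix_index'[OF M sub(2) sub(2)])
  have "M = four_block_mat ?A (0\<^sub>m k (n - k)) (0\<^sub>m (n - k) k) ?D"
    using M cA cD k zero by (intro eq_matI) (auto simp: iA iD)
  then have "det M = det ?A * det ?D"
    using det_four_block_mat_upper_right_zero[OF cA refl _ cD] by (metis zero_carrier_mat)
  moreover have "{0..<n} - {0..<k} = {k..<n}" by auto
  moreover have "sgn_pair {0..<k} {0..<k} = 1"
    unfolding sgn_pair_def by (simp flip: mult_2 add: power_mult)
  ultimately show "det M = sgn_pair {0..<k} {0..<k} * minor M {0..<k} {0..<k} *
      minor M ({0..<n} - {0..<k}) ({0..<n} - {0..<k})"
    by (simp add: minor_def)
qed

lemma det_factors_swap: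
  assumes f: "det_factors n (insert i (\<alpha> - {Suc i})) \<beta>"
    and sub: "\<alpha> \<subseteq> {0..<n}" "\<beta> \<subseteq> {0..<n}" and i: "i \<notin> \<alpha>" "Suc i \<in> \<alpha>"
  shows "det_factors n \<alpha> \<beta>"
  unfolding det_factors_def
proof (intro ballI impI)
  fix M :: "real mat"
  assume M: "M \<in> carrier_mat n n"
    and zero: "\<forall>i<n. \<forall>j<n. (i \<in> \<alpha>) \<noteq> (j \<in> \<beta>) \<longrightarrow> M $$ (i, j) = 0"
  define \<alpha>' where "\<alpha>' = insert i (\<alpha> - {Suc i})"
  define N where "N = swaprows i (Suc i) M"
  have lt: "i < n" "Suc i < n" using i sub by auto
  have N: "N \<in> carrier_mat n n" unfolding N_def using M by simp
  have detN: "det N = - det M" unfolding N_def using lt M by (intro det_swaprows) auto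
  have "\<forall>a<n. \<forall>b<n. (a \<in> \<alpha>') \<noteq> (b \<in> \<beta>) \<longrightarrow> N $$ (a, b) = 0"
    using zero i lt M unfolding \<alpha>'_def N_def by (auto split: if_splits)
  then have fac: "det N = sgn_pair \<alpha>' \<beta> * minor N \<alpha>' \<beta> * minor N ({0..<n} - \<alpha>') ({0..<n} - \<beta>)"
    using f N unfolding det_factors_def \<alpha>'_def by blast
  have fin: "finite \<alpha>" using sub(1) finite_subset by blast
  have "sum Suc \<alpha> = Suc (sum Suc \<alpha>')"
    using i fin sum.remove[OF fin i(2), of Suc] unfolding \<alpha>'_def by simp
  then have sgn: "sgn_pair \<alpha>' \<beta> = - sgn_pair \<alpha> \<beta>" unfolding sgn_pair_def by simp
  \<comment> \<open>These are the restrictions of the transposition of \<open>i\<close> and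
    \<open>Suc i\<close> to \<alpha> and to its complement. Each is strictly increasing there, since
    exactly one of the two indices lies in \<alpha>.\<close>
  let ?f = "\<lambda>x. if x = Suc i then i else x" and ?g = "\<lambda>x. if x = i then Suc i else x"
  have img: "\<alpha>' = ?f ` \<alpha>" "{0..<n} - \<alpha>' = ?g ` ({0..<n} - \<alpha>)"
    unfolding \<alpha>'_def using i lt by (auto simp: image_iff)
  have "minor N \<alpha>' \<beta> = minor M \<alpha> \<beta>"
    unfolding minor_def img(1)
    using sub i lt M
    by (intro arg_cong[of _ _ det] submatrix_reindex_rows[OF M N])
      (auto simp: strict_mono_on_def N_def less_Suc_eq Suc_lessI  dest: Suc_lessI)
  moreover have "minor N ({0..<n} - \<alpha>') ({0..<n} - \<beta>) = minor M ({0..<n} - \<alpha>) ({0..<n} - \<beta>)"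
    unfolding minor_def img(2)
    using i lt M
    by (intro arg_cong[of _ _ det] submatrix_reindex_rows[OF M N])
      (auto simp: strict_mono_on_def N_def dest: Suc_lessI)
  ultimately show "det M = sgn_pair \<alpha> \<beta> * minor M \<alpha> \<beta> * minor M ({0..<n} - \<alpha>) ({0..<n} - \<beta>)"
    using fac sgn detN by simp
qed

text \<open>Each swap lowers the sum of the elements of \<alpha> by one, so the process ends; a set
  admitting no further swap is closed downwards and hence an initial segment.\<close>

lemma det_factors_from_initial_rows:
  assumes init: "det_factors n {0..<card \<alpha>} \<beta>"
    and sub: "\<alpha> \<subseteq> {0..<n}" "\<beta> \<subseteq> {0..<n}"
  shows "det_factors n \<alpha> \<beta>"
  using init sub(1)
proof (induction "\<Sum>\<alpha>" arbitrary: \<alpha> rule: less_induct)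
  case less
  have fin: "finite \<alpha>" using less.prems finite_subset by blast
  show ?case
  proof (cases "\<exists>i. i \<notin> \<alpha> \<and> Suc i \<in> \<alpha>")
    case True
    then obtain i where i: "i \<notin> \<alpha>" "Suc i \<in> \<alpha>" by blast
    let ?\<alpha> = "insert i (\<alpha> - {Suc i})"
    have "\<Sum>\<alpha> = Suc i + \<Sum>(\<alpha> - {Suc i})" using fin i(2) by (rule sum.remove)
    then have "\<Sum>?\<alpha> < \<Sum>\<alpha>" using i fin by simp
    moreover have "card ?\<alpha> = card \<alpha>"
      using i fin card_gt_0_iff[of \<alpha>] by (auto simp: card_Diff_singleton)
    moreover have "?\<alpha> \<subseteq> {0..<n}" using less.prems i by auto
    ultimately have "det_factors n ?\<alpha> \<beta>" using less by metis
    then show ?thesis using det_factors_swap less.prems(2) sub(2) i by blast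
  next
    case False
    have down: "j \<in> \<alpha>" if "i \<in> \<alpha>" "j \<le> i" for i j
      using that(2,1) False by (induction rule: inc_induct) auto
    have "\<alpha> = {0..<card \<alpha>}"
    proof (rule card_subset_eq[symmetric])
      show "{0..<card \<alpha>} \<subseteq> \<alpha>"
      proof
        fix j assume "j \<in> {0..<card \<alpha>}"
        then have "\<not> \<alpha> \<subseteq> {0..<j}" using card_mono[of "{0..<j}" \<alpha>] by auto
        then obtain i where "i \<in> \<alpha>" "i \<notin> {0..<j}" by blast
        then show "j \<in> \<alpha>" using down by simp
      qed
    qed (use fin in auto)
    then show ?thesis using less.prems(1) by simp
  qed
qed

lemma det_factors_card_eq:
  assumes sub: "\<alpha> \<subseteq> {0..<n}" "\<beta> \<subseteq> {0..<n}" and card: "card \<alpha> = card \<beta>"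
  shows "det_factors n \<alpha> \<beta>"
proof -
  have le: "card \<beta> \<le> n" using card_mono[OF _ sub(2)] by simp
  \<comment> \<open>Row swaps first carry the sorted pair to row set \<beta>; the transpose makes
    \<beta> the column set, and row swaps then produce \<alpha>.\<close>
  then have "det_factors n \<beta> {0..<card \<beta>}"
    using det_factors_from_initial_rows[OF det_factors_initial sub(2)] by simp
  then have "det_factors n {0..<card \<beta>} \<beta>"
    using det_factors_transpose[of n \<beta> "{0..<card \<beta>}"] sub le by simp
  then show ?thesis using det_factors_from_initial_rows[OF _ sub] card by simp
qed

section \<open>Laplace expansion along a set of rows\<close>

text \<open>Keeping the block on \<alpha> and \<beta> together with the complementary block makes a
  single full determinant equal to one signed Laplace term, as \<open>det_mask\<close>
  shows.\<close>

definition mask :: "nat set \<Rightarrow> nat set \<Rightarrow> 'a::zero mat \<Rightarrow> 'a mat" where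
  "mask \<alpha> \<beta> M = mat (dim_row M) (dim_col M) (\<lambda>(i, j). if i \<in> \<alpha> \<longleftrightarrow> j \<in> \<beta> then M $$ (i, j) else 0)"

lemma mask_carrier [simp]: "mask \<alpha> \<beta> M \<in> carrier_mat n m \<longleftrightarrow> M \<in> carrier_mat n m"
  unfolding mask_def carrier_mat_def by simp

lemma mask_index:
  "M \<in> carrier_mat n m \<Longrightarrow> i < n \<Longrightarrow> j < m \<Longrightarrow>
    mask \<alpha> \<beta> M $$ (i, j) = (if i \<in> \<alpha> \<longleftrightarrow> j \<in> \<beta> then M $$ (i, j) else 0)"
  unfolding mask_def by simp

lemma finite_Q [simp]: "finite (Q k n)"
  unfolding Q_def by (rule finite_subset[of _ "Pow {0..<n}"]) auto

lemma complement_Q: "\<beta> \<in> Q k n \<Longrightarrow> {0..<n} - \<beta> \<in> Q (n - k) n"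
  unfolding Q_def by (simp add: card_complement)

lemma double_complement_Q: "\<beta> \<in> Q k n \<Longrightarrow> {0..<n} - ({0..<n} - \<beta>) = \<beta>"
  unfolding Q_def by auto

lemma Q_self: "Q n n = {{0..<n}}"
  unfolding Q_def using card_subset_eq[of "{0..<n}"] by auto

text \<open>Groups the Leibniz formula by the image of \<alpha>: the product of a permutation
  \<open>p\<close> is unchanged by the mask with \<beta> equal to the image of \<alpha> under
  \<open>p\<close>, and every other mask puts a zero factor into it.\<close>

lemma det_expand_mask:
  fixes M :: "'a::comm_ring_1 mat"
  assumes M: "M \<in> carrier_mat n n" and \<alpha>: "\<alpha> \<in> Q k n"
  shows "det M = (\<Sum>\<beta>\<in>Q k n. det (mask \<alpha> \<beta> M))"
proof -
  let ?P = "{p. p permutes {0..<n}}"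
  have \<alpha>': "\<alpha> \<subseteq> {0..<n}" "card \<alpha> = k" using \<alpha> unfolding Q_def by auto
  have inner: "(\<Sum>\<beta>\<in>Q k n. \<Prod>i = 0..<n. mask \<alpha> \<beta> M $$ (i, p i)) = (\<Prod>i = 0..<n. M $$ (i, p i))"
    if p: "p permutes {0..<n}" for p
  proof -
    have inj: "inj p" using p by (rule permutes_inj)
    have lt: "p i < n" if "i < n" for i
      using permutes_in_image[OF p, of i] that by simp
    have mem: "p ` \<alpha> \<in> Q k n"
      using \<alpha>' lt inj unfolding Q_def by (auto simp: card_image inj_on_subset)
    have "(\<Prod>i = 0..<n. mask \<alpha> \<beta> M $$ (i, p i)) = 0" if \<beta>: "\<beta> \<in> Q k n - {p ` \<alpha>}" for \<beta>
    proof -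
      have "\<exists>i<n. (i \<in> \<alpha>) \<noteq> (p i \<in> \<beta>)"
      proof (rule ccontr)
        assume "\<not> ?thesis"
        then have eq: "(i \<in> \<alpha>) = (p i \<in> \<beta>)" if "i < n" for i using that by blast
        have "x \<in> \<beta> \<longleftrightarrow> x \<in> p ` \<alpha>" if x: "x \<in> {0..<n}" for x
        proof -
          obtain i where "i < n" "x = p i" using x permutes_image[OF p] by fastforce
          then show ?thesis using eq inj by (simp add: inj_image_mem_iff)
        qed
        then have "\<beta> = p ` \<alpha>" using \<beta> mem unfolding Q_def by blast
        then show False using \<beta> by simp
      qed
      then obtain i where "i < n" "(i \<in> \<alpha>) \<noteq> (p i \<in> \<beta>)" by blast
      then show ?thesis using lt by (intro prod_zero) (auto simp: mask_index[OF M])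
    qed
    then have "(\<Sum>\<beta>\<in>Q k n. \<Prod>i = 0..<n. mask \<alpha> \<beta> M $$ (i, p i)) =
        (\<Prod>i = 0..<n. mask \<alpha> (p ` \<alpha>) M $$ (i, p i))"
      using mem by (subst sum.remove[OF _ mem]) auto
    also have "\<dots> = (\<Prod>i = 0..<n. M $$ (i, p i))"
      using lt inj by (intro prod.cong) (auto simp: mask_index[OF M] inj_image_mem_iff)
    finally show ?thesis .
  qed
  have "(\<Sum>\<beta>\<in>Q k n. det (mask \<alpha> \<beta> M)) =
      (\<Sum>\<beta>\<in>Q k n. \<Sum>p\<in>?P. signof p * (\<Prod>i = 0..<n. mask \<alpha> \<beta> M $$ (i, p i)))"
    using M by (simp add: det_def'[of _ n])
  also have "\<dots> = (\<Sum>p\<in>?P. signof p * (\<Sum>\<beta>\<in>Q k n. \<Prod>i = 0..<n. mask \<alpha> \<beta> M $$ (i, p i)))"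
    by (subst sum.swap) (simp add: sum_distrib_left)
  also have "\<dots> = det M"
    unfolding det_def'[OF M] by (intro sum.cong) (simp_all add: inner)
  finally show ?thesis by simp
qed

lemma minor_cong:
  assumes M: "M \<in> carrier_mat n m" and N: "N \<in> carrier_mat n m"
    and I: "I \<subseteq> {0..<n}" and J: "J \<subseteq> {0..<m}"
    and entries: "\<And>i j. i \<in> I \<Longrightarrow> j \<in> J \<Longrightarrow> N $$ (i, j) = M $$ (i, j)"
  shows "minor N I J = minor M I J"
  unfolding minor_def
proof (intro arg_cong[of _ _ det] eq_matI)
  note cM = submatrix_carrier[OF M I J] and cN = submatrix_carrier[OF N I J]
  show "dim_row (submatrix N I J) = dim_row (submatrix M I J)"
    "dim_col (submatrix N I J) = dim_col (submatrix M I J)"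
    using cM cN by auto
  fix i j assume "i < dim_row (submatrix M I J)" "j < dim_col (submatrix M I J)"
  then have ij: "i < card I" "j < card J" using cM by auto
  then show "submatrix N I J $$ (i, j) = submatrix M I J $$ (i, j)"
    by (simp add: submatrix_index'[OF N I J] submatrix_index'[OF M I J] entries pick_in_set_le)
qed

text \<open>The mask has the zero pattern required by \<open>det_factors\<close>, and the two minors
  only see entries that it keeps. With \<open>det_expand_mask\<close> this is the generalized
  Laplace expansion.\<close>

lemma det_mask:
  assumes M: "M \<in> carrier_mat n n" and Q: "\<alpha> \<in> Q k n" "\<beta> \<in> Q k n"
  shows "det (mask \<alpha> \<beta> M) = sgn_pair \<alpha> \<beta> * minor M \<alpha> \<beta> * minor M ({0..<n} - \<alpha>) ({0..<n} - \<beta>)"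
proof -
  have sub: "\<alpha> \<subseteq> {0..<n}" "\<beta> \<subseteq> {0..<n}" and card: "card \<alpha> = card \<beta>"
    using Q unfolding Q_def by auto
  have "det (mask \<alpha> \<beta> M) = sgn_pair \<alpha> \<beta> * minor (mask \<alpha> \<beta> M) \<alpha> \<beta> *
      minor (mask \<alpha> \<beta> M) ({0..<n} - \<alpha>) ({0..<n} - \<beta>)"
    using det_factors_card_eq[OF sub card] M unfolding det_factors_def
    by (elim ballE[of _ _ "mask \<alpha> \<beta> M"]) (auto simp: mask_index[OF M])
  moreover have "minor (mask \<alpha> \<beta> M) \<alpha> \<beta> = minor M \<alpha> \<beta>"
    using M sub by (intro minor_cong[of _ n n]) (auto simp: mask_index[OF M] subset_iff)
  moreover have "minor (mask \<alpha> \<beta> M) ({0..<n} - \<alpha>) ({0..<n} - \<beta>) = minor M ({0..<n} - \<alpha>) ({0..<n} - \<beta>)"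
    using M by (intro minor_cong[of _ n n]) (auto simp: mask_index[OF M])
  ultimately show ?thesis by simp
qed

text \<open>This symmetry reduces sizes above one half to sizes at most one half.\<close>

lemma mask_complement:
  "M \<in> carrier_mat n n \<Longrightarrow> mask ({0..<n} - \<alpha>) ({0..<n} - \<beta>) M = mask \<alpha> \<beta> M"
  unfolding mask_def by (intro eq_matI) auto

section \<open>Principal minors of a diagonalized matrix\<close>

lemma det_zero_row:
  fixes M :: "'a::comm_ring_1 mat"
  assumes M: "M \<in> carrier_mat n n" and "i < n" "\<And>j. j < n \<Longrightarrow> M $$ (i, j) = 0"
  shows "det M = 0"
  unfolding det_def'[OF M]
proof (intro sum.neutral ballI)
  fix p assume "p \<in> {p. p permutes {0..<n}}"
  then have "p i < n" using permutes_in_image[of p "{0..<n}" i] \<open>i < n\<close> by simp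
  then have "(\<Prod>l = 0..<n. M $$ (l, p l)) = 0"
    using assms by (intro prod_zero bexI[of _ i]) auto
  then show "signof p * (\<Prod>l = 0..<n. M $$ (l, p l)) = 0" by simp
qed

lemma minor_one:
  assumes I: "I \<subseteq> {0..<n}"
  shows "minor (1\<^sub>m n) I I = 1"
proof -
  have "submatrix (1\<^sub>m n :: real mat) I I = 1\<^sub>m (card I)"
  proof (rule eq_matI)
    fix i j assume "i < dim_row (1\<^sub>m (card I) :: real mat)" "j < dim_col (1\<^sub>m (card I) :: real mat)"
    then have ij: "i < card I" "j < card I" by auto
    have "pick I i < n" "pick I j < n"
      using I pick_in_set_le[OF ij(1)] pick_in_set_le[OF ij(2)] by auto
    moreover have "pick I i = pick I j \<longleftrightarrow> i = j"
      using ij strict_mono_on_imp_inj_on[OF strict_mono_on_pick, of I] by (simp add: inj_on_eq_iff)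
    ultimately show "submatrix (1\<^sub>m n) I I $$ (i, j) = (1\<^sub>m (card I) :: real mat) $$ (i, j)"
      using ij I by (auto simp: submatrix_index'[OF one_carrier_mat I I])
  qed (use submatrix_carrier[OF one_carrier_mat I I] in auto)
  then show ?thesis unfolding minor_def by simp
qed

text \<open>Padding realises a principal minor as a full determinant, so that a product of matrices can be
  handled by \<^const>\<open>det\<close> being multiplicative instead of by the Cauchy--Binet formula.\<close>

lemma det_pad_identity_rows:
  assumes B: "B \<in> carrier_mat n n" and \<alpha>: "\<alpha> \<subseteq> {0..<n}"
  shows "det (mat n n (\<lambda>(i, j). if i \<in> \<alpha> then B $$ (i, j) else 1\<^sub>m n $$ (i, j))) = minor B \<alpha> \<alpha>"
    (is "det ?C = _")
proof -
  let ?k = "card \<alpha>"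
  have C: "?C \<in> carrier_mat n n" by simp
  have mem: "\<alpha> \<in> Q ?k n" using \<alpha> unfolding Q_def by simp
  have "det (mask \<alpha> \<beta> ?C) = 0" if "\<beta> \<in> Q ?k n - {\<alpha>}" for \<beta>
  proof -
    have \<beta>: "\<beta> \<subseteq> {0..<n}" "card \<beta> = ?k" "\<beta> \<noteq> \<alpha>" using that unfolding Q_def by auto
    have "finite \<alpha>" using \<alpha> finite_subset by blast
    \<comment> \<open>Row \<open>i\<close> of the padded matrix is a unit vector whose only nonzero
      entry is on the diagonal, and the mask deletes that entry because \<open>i\<close> is in
      \<beta> but not in \<alpha>.\<close>
    then obtain i where i: "i \<in> \<beta>" "i \<notin> \<alpha>" using \<beta> card_subset_eq by blast
    then show ?thesis
      using \<beta>(1) by (intro det_zero_row[of _ n i]) (auto simp: mask_index[OF C])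
  qed
  then have "det ?C = det (mask \<alpha> \<alpha> ?C)"
    unfolding det_expand_mask[OF C mem] using mem by (subst sum.remove[OF _ mem]) auto
  also have "\<dots> = sgn_pair \<alpha> \<alpha> * minor ?C \<alpha> \<alpha> * minor ?C ({0..<n} - \<alpha>) ({0..<n} - \<alpha>)"
    by (rule det_mask[OF C mem mem])
  also have "minor ?C \<alpha> \<alpha> = minor B \<alpha> \<alpha>"
    using \<alpha> by (intro minor_cong[OF B]) (auto simp: subset_iff)
  also have "minor ?C ({0..<n} - \<alpha>) ({0..<n} - \<alpha>) = minor (1\<^sub>m n) ({0..<n} - \<alpha>) ({0..<n} - \<alpha>)"
    by (intro minor_cong[of _ n n]) auto
  also have "\<dots> = 1" by (rule minor_one) auto
  also have "sgn_pair \<alpha> \<alpha> = 1"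
    unfolding sgn_pair_def by (simp flip: mult_2 add: power_mult)
  finally show ?thesis by simp
qed

lemma det_mat_diag: "det (mat_diag n f) = (\<Prod>i = 0..<n. f i :: 'a::comm_ring_1)"
proof -
  have "det (mat_diag n f) = prod_list (diag_mat (mat_diag n f))"
    by (rule det_upper_triangular[of _ n]) (auto simp: mat_diag_def)
  also have "\<dots> = (\<Prod>i = 0..<n. f i)"
    unfolding prod_list_diag_prod by (simp add: mat_diag_def)
  finally show ?thesis .
qed

lemma principal_minor_diagonalized:
  assumes T: "T \<in> carrier_mat n n" and T': "T' \<in> carrier_mat n n" and inv: "T * T' = 1\<^sub>m n"
    and \<alpha>: "\<alpha> \<in> Q k n"
  shows "minor (T * mat_diag n e * T') \<alpha> \<alpha> =
    det T' * (\<Sum>\<beta>\<in>Q k n. det (mask \<alpha> \<beta> T) * (\<Prod>j\<in>\<beta>. e j))"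
proof -
  let ?E = "mat_diag n e" and ?B = "T * mat_diag n e * T'"
  define G where "G = mat n n (\<lambda>(i, j). if i \<in> \<alpha> then (T * ?E) $$ (i, j) else T $$ (i, j))"
  have TE: "T * ?E \<in> carrier_mat n n" using T by simp
  have B: "?B \<in> carrier_mat n n" using TE T' by simp
  have G: "G \<in> carrier_mat n n" unfolding G_def by simp
  have row: "row G i = (if i \<in> \<alpha> then row (T * ?E) i else row T i)" if "i < n" for i
    using that T TE unfolding G_def
    by (intro eq_vecI) (auto simp: carrier_matD[OF mat_diag_dim])
  \<comment> \<open>Reading the identity as \<open>T * T'\<close> turns its rows outside \<alpha>
    into rows of \<open>T\<close> times \<open>T'\<close>, so the whole padded matrix has the right
    factor \<open>T'\<close>.\<close>
  have "mat n n (\<lambda>(i, j). if i \<in> \<alpha> then ?B $$ (i, j) else 1\<^sub>m n $$ (i, j)) = G * T'"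
  proof (rule eq_matI)
    fix i j assume "i < dim_row (G * T')" "j < dim_col (G * T')"
    then have ij: "i < n" "j < n" using G T' by auto
    show "mat n n (\<lambda>(i, j). if i \<in> \<alpha> then ?B $$ (i, j) else 1\<^sub>m n $$ (i, j)) $$ (i, j) = (G * T') $$ (i, j)"
      unfolding inv[symmetric] using ij G T T' TE row[OF ij(1)] by simp
  qed (use G T' in auto)
  then have "minor ?B \<alpha> \<alpha> = det G * det T'"
    using det_pad_identity_rows[OF B, of \<alpha>] \<alpha> det_mult[OF G T'] by (simp add: Q_def)
  moreover have "det (mask \<alpha> \<beta> G) = det (mask \<alpha> \<beta> T) * (\<Prod>j\<in>\<beta>. e j)" if \<beta>: "\<beta> \<in> Q k n" for \<beta>
  proof -
    let ?e = "\<lambda>j. if j \<in> \<beta> then e j else 1"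
    \<comment> \<open>In \<open>G\<close> the columns are scaled only in the rows of \<alpha>. After
      masking, those rows live on the columns in \<beta> and the other rows on the remaining
      columns, so the scaling becomes one by whole columns.\<close>
    have "mask \<alpha> \<beta> G = mask \<alpha> \<beta> T * mat_diag n ?e"
      using T G unfolding mat_diag_mult_right[OF mask_carrier[THEN iffD2, OF T]]
      by (intro eq_matI)
        (auto simp: mask_index[OF G] mask_index[OF T] mat_diag_mult_right[OF T] G_def mask_def)
    moreover have "(\<Prod>j = 0..<n. ?e j) = (\<Prod>j\<in>\<beta>. e j)"
      using \<beta> unfolding Q_def by (intro prod.mono_neutral_cong_right) auto
    ultimately show ?thesis
      using T by (simp add: det_mult[of _ n] det_mat_diag)
  qed
  ultimately show ?thesis
    by (simp add: det_expand_mask[OF G \<alpha>])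
qed

section \<open>Exponential of a diagonalized matrix\<close>

lemma mat_diag_pow: "mat_diag n f ^\<^sub>m k = mat_diag n (\<lambda>i. f i ^ k :: 'a::semiring_1)"
  by (induction k) (simp_all add: carrier_matD[OF mat_diag_dim] power_commutes)

lemma diagonalized_index:
  fixes T T' :: "'a::comm_semiring_1 mat"
  assumes T: "T \<in> carrier_mat n n" and T': "T' \<in> carrier_mat n n" and ij: "i < n" "j < n"
  shows "(T * mat_diag n f * T') $$ (i, j) = (\<Sum>l = 0..<n. T $$ (i, l) * T' $$ (l, j) * f l)"
  unfolding mat_diag_mult_right[OF T] using T' ij
  by (auto simp: scalar_prod_def mult_ac intro!: sum.cong)

text \<open>Powers act on the diagonal factor alone, so each entrywise series is a finite linear
  combination of scalar exponential series.\<close>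

lemma exp_mat_diagonalized:
  assumes T: "T \<in> carrier_mat n n" and T': "T' \<in> carrier_mat n n"
    and inv: "T * T' = 1\<^sub>m n" "T' * T = 1\<^sub>m n"
  shows "exp_mat (T * mat_diag n f * T') = T * mat_diag n (\<lambda>i. exp (f i)) * T'"
proof (rule eq_matI)
  let ?A = "T * mat_diag n f * T'" and ?R = "T * mat_diag n (\<lambda>i. exp (f i)) * T'"
  have A: "?A \<in> carrier_mat n n" using T T' by (metis mat_diag_dim mult_carrier_mat)
  have "similar_mat_wit ?A (mat_diag n f) T T'"
    using A T T' inv unfolding similar_mat_wit_def Let_def by auto
  then have pow: "?A ^\<^sub>m k = T * mat_diag n (\<lambda>i. f i ^ k) * T'" for k
    using similar_mat_wit_pow_id by (metis mat_diag_pow)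
  fix i j assume "i < dim_row ?R" "j < dim_col ?R"
  then have ij: "i < n" "j < n" using T T' by auto
  have "(\<lambda>k. (?A ^\<^sub>m k) $$ (i, j) / fact k) =
      (\<lambda>k. \<Sum>l = 0..<n. T $$ (i, l) * T' $$ (l, j) * (f l ^ k /\<^sub>R fact k))"
    unfolding pow diagonalized_index[OF T T' ij]
    by (simp add: divide_inverse sum_distrib_left mult_ac)
  also have "\<dots> sums (\<Sum>l = 0..<n. T $$ (i, l) * T' $$ (l, j) * exp (f l))"
    by (intro sums_sum sums_mult exp_converges)
  finally show "exp_mat ?A $$ (i, j) = ?R $$ (i, j)"
    using T T' ij unfolding diagonalized_index[OF T T' ij] by (simp add: exp_mat_def sums_iff)
qed (use T T' in \<open>auto simp: exp_mat_def\<close>)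

section \<open>Signs of the Laplace terms and positivity of the minors\<close>

lemma mask_dets_nonneg:
  fixes T :: "real mat"
  assumes T: "T \<in> carrier_mat n n" and det: "det T \<noteq> 0" and \<alpha>: "\<alpha> \<in> Q k n" and k: "k \<ge> 1"
    and half: "\<And>k \<alpha>. k \<ge> 1 \<Longrightarrow> int k \<le> \<lceil>(real n - 1) / 2\<rceil> \<Longrightarrow> \<alpha> \<in> Q k n \<Longrightarrow>
      (\<forall>\<beta>\<in>Q k n. det T * det (mask \<alpha> \<beta> T) \<ge> 0) \<and> (\<exists>\<beta>\<in>Q k n. det T * det (mask \<alpha> \<beta> T) > 0)"
  shows "(\<forall>\<beta>\<in>Q k n. det T * det (mask \<alpha> \<beta> T) \<ge> 0) \<and> (\<exists>\<beta>\<in>Q k n. det T * det (mask \<alpha> \<beta> T) > 0)"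
proof -
  have le: "k \<le> n" using \<alpha> card_mono[of "{0..<n}" \<alpha>] unfolding Q_def by auto
  consider "int k \<le> \<lceil>(real n - 1) / 2\<rceil>" | "k = n" | "k < n" "\<not> int k \<le> \<lceil>(real n - 1) / 2\<rceil>"
    using le by linarith
  then show ?thesis
  proof cases
    case 1
    then show ?thesis using half k \<alpha> by blast
  next
    case 2
    \<comment> \<open>The complement is empty here, so the symmetry cannot be used; the only term is
      the square of \<open>det T\<close>.\<close>
    then have "\<alpha> = {0..<n}" using \<alpha> Q_self by auto
    moreover have "mask {0..<n} {0..<n} T = T"
      using T by (intro eq_matI) (auto simp: mask_def)
    ultimately show ?thesis
      using det 2 by (auto simp: Q_self not_square_less_zero zero_less_mult_iff linorder_neq_iff)
  next
    case 3
    \<comment> \<open>The inequality \<open>k > (n - 1) / 2\<close> is equivalent to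
      \<open>n - k - 1 < (n - 1) / 2\<close>, which is the condition for \<open>n - k\<close> to be
      at most the ceiling.\<close>
    have "real_of_int (int k) > (real n - 1) / 2" using 3(2) by (simp only: ceiling_less_iff not_le)
    then have "int (n - k) \<le> \<lceil>(real n - 1) / 2\<rceil>"
      using 3(1) by (simp add: le_ceiling_iff of_nat_diff)
    moreover have "n - k \<ge> 1" using 3 by simp
    ultimately have *: "(\<forall>\<beta>\<in>Q (n - k) n. det T * det (mask ({0..<n} - \<alpha>) \<beta> T) \<ge> 0) \<and>
        (\<exists>\<beta>\<in>Q (n - k) n. det T * det (mask ({0..<n} - \<alpha>) \<beta> T) > 0)"
      using half complement_Q[OF \<alpha>] by blast
    then obtain \<gamma> where \<gamma>: "\<gamma> \<in> Q (n - k) n" "det T * det (mask ({0..<n} - \<alpha>) \<gamma> T) > 0" by blast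
    have "{0..<n} - \<gamma> \<in> Q k n" using complement_Q[OF \<gamma>(1)] le by simp
    moreover have "mask ({0..<n} - \<alpha>) \<gamma> T = mask \<alpha> ({0..<n} - \<gamma>) T"
      using mask_complement[OF T, of \<alpha> "{0..<n} - \<gamma>"] double_complement_Q[OF \<gamma>(1)] by simp
    ultimately show ?thesis
      using * \<gamma>(2) complement_Q mask_complement[OF T] by metis
  qed
qed

theorem theorem9:
  fixes n :: nat and A T T' D :: "real mat" and lam :: "nat \<Rightarrow> real"
  assumes "A \<in> carrier_mat n n"
    and "char_poly A = (\<Prod>i<n. [:- lam i, 1:])"
    and "T \<in> carrier_mat n n" and "T' \<in> carrier_mat n n"
    and "inverts_mat T T'" and "inverts_mat T' T"
    and "D = mat_diag n lam"
    and "A = T * D * T'"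
    and "\<And>k \<alpha>. k \<ge> 1 \<Longrightarrow> int k \<le> \<lceil>(real n - 1) / 2\<rceil> \<Longrightarrow> \<alpha> \<in> Q k n \<Longrightarrow>
       (\<forall>\<beta>\<in>Q k n. det T * sgn_pair \<alpha> \<beta> * minor T \<alpha> \<beta> * minor T ({0..<n} - \<alpha>) ({0..<n} - \<beta>) \<ge> 0) \<and>
       (\<exists>\<beta>\<in>Q k n. det T * sgn_pair \<alpha> \<beta> * minor T \<alpha> \<beta> * minor T ({0..<n} - \<alpha>) ({0..<n} - \<beta>) > 0)"
  shows "EP_matrix A"
proof -
  note T = assms(3) and T' = assms(4)
  have inv: "T * T' = 1\<^sub>m n" "T' * T = 1\<^sub>m n"
    using assms(5,6) T T' unfolding inverts_mat_def by auto
  have dets: "det T * det T' = 1" using det_mult[OF T T'] inv by simp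
  then have det: "det T \<noteq> 0" by auto
  \<comment> \<open>The factor \<open>det T'\<close> in front of the Laplace sum is traded for
    \<open>det T\<close> times a positive square, which brings the sum into the form whose signs are
    assumed.\<close>
  have detT': "det T' = det T * (det T')\<^sup>2" using dets by (simp add: power2_eq_square flip: mult.assoc)
  have "P_matrix (exp_mat (t \<cdot>\<^sub>m A))" if "t \<ge> 0" for t
  proof -
    let ?e = "\<lambda>i. exp (t * lam i)"
    have "t \<cdot>\<^sub>m A = T * mat_diag n (\<lambda>i. t * lam i) * T'"
      unfolding assms(7,8) using T T'
      by (intro eq_matI) (auto simp: diagonalized_index[OF T T'] sum_distrib_left mult_ac simp del: index_mult_mat(1))
    then have exp: "exp_mat (t \<cdot>\<^sub>m A) = T * mat_diag n ?e * T'"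
      using exp_mat_diagonalized[OF T T' inv] by simp
    have "minor (exp_mat (t \<cdot>\<^sub>m A)) \<alpha> \<alpha> > 0" if \<alpha>: "\<alpha> \<noteq> {}" "\<alpha> \<subseteq> {0..<n}" for \<alpha>
    proof -
      let ?k = "card \<alpha>"
      have mem: "\<alpha> \<in> Q ?k n" and k: "?k \<ge> 1"
        using \<alpha> finite_subset[OF \<alpha>(2)] by (auto simp: Q_def Suc_le_eq card_gt_0_iff)
      have sgn: "(\<forall>\<beta>\<in>Q ?k n. det T * det (mask \<alpha> \<beta> T) \<ge> 0) \<and> (\<exists>\<beta>\<in>Q ?k n. det T * det (mask \<alpha> \<beta> T) > 0)"
        using assms(9) by (intro mask_dets_nonneg[OF T det mem k]) (simp add: det_mask[OF T] mult.assoc)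
      then obtain \<beta> where \<beta>: "\<beta> \<in> Q ?k n" "det T * det (mask \<alpha> \<beta> T) > 0" by blast
      have "(\<Sum>\<beta>\<in>Q ?k n. det T * det (mask \<alpha> \<beta> T) * (\<Prod>j\<in>\<beta>. ?e j)) > 0"
      proof (rule sum_pos2[OF finite_Q \<beta>(1)])
        have pos: "(\<Prod>j\<in>\<gamma>. ?e j) > 0" for \<gamma> by (simp add: prod_pos)
        show "det T * det (mask \<alpha> \<beta> T) * (\<Prod>j\<in>\<beta>. ?e j) > 0"
          using \<beta>(2) pos by (rule mult_pos_pos)
        show "det T * det (mask \<alpha> \<gamma> T) * (\<Prod>j\<in>\<gamma>. ?e j) \<ge> 0" if "\<gamma> \<in> Q ?k n" for \<gamma>
          using sgn that by (intro mult_nonneg_nonneg[OF _ less_imp_le[OF pos]]) blast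
      qed
      moreover have "(det T')\<^sup>2 > 0" using dets by auto
      ultimately have "(det T')\<^sup>2 * (\<Sum>\<beta>\<in>Q ?k n. det T * det (mask \<alpha> \<beta> T) * (\<Prod>j\<in>\<beta>. ?e j)) > 0"
        by (rule mult_pos_pos[rotated])
      also have "(det T')\<^sup>2 * (\<Sum>\<beta>\<in>Q ?k n. det T * det (mask \<alpha> \<beta> T) * (\<Prod>j\<in>\<beta>. ?e j)) =
          det T' * (\<Sum>\<beta>\<in>Q ?k n. det (mask \<alpha> \<beta> T) * (\<Prod>j\<in>\<beta>. ?e j))"
        by (subst (2) detT') (simp add: sum_distrib_left mult_ac)
      also have "\<dots> = minor (exp_mat (t \<cdot>\<^sub>m A)) \<alpha> \<alpha>"
        unfolding exp by (rule principal_minor_diagonalized[OF T T' inv(1) mem, symmetric])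
      finally show ?thesis .
    qed
    moreover have "exp_mat (t \<cdot>\<^sub>m A) \<in> carrier_mat n n" using assms(1) by (simp add: exp_mat_def)
    ultimately show ?thesis unfolding P_matrix_def by auto
  qed
  then show ?thesis using assms(1) unfolding EP_matrix_def by auto
qed

end
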